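(* Let $T$ be a moon polyomino with $s$ rows and $t$ columns, let $\mathbf{m}=(m_1,\ldots,m_s)$ be an $s$-tuple of nonnegative integers, and let $A$ be a subset of $\{1,\ldots,t\}$. Let $R_{i_1}\prec R_{i_2}\prec\cdots\prec R_{i_s}$ be the rows of $T$ listed in the order $\prec$, and for $j=1,\ldots,s$ set $$h_{i_j}=r_{i_j}-(m_{i_1}+m_{i_2}+\cdots+m_{i_{j-1}})-a_{i_j},$$ where $r_{i_j}$ is the length of the row $R_{i_j}$ and $a_{i_j}$ is the number of $k\in A$ such that the column labelled $k$ intersects the row $R_{i_j}$. Then the distribution of the joint statistic $(\mathrm{ne}_2,\mathrm{se}_2)$ over $\mathcal{N}(T,\mathbf{m};A)$ is given by $$\sum_{F\in \mathcal{N}(T,\mathbf{m};A)}p^{\mathrm{ne}_2(F)}q^{\mathrm{se}_2(F)}=\prod_{j=1}^s\left[{h_j\atop m_j}\right]_{p,q}.$$ In particular, $$|\mathcal{N}(T,\mathbf{m};A)|=\prod_{j=1}^s\binom{h_j}{m_j}.$$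
   Context: A polyomino is an arrangement (finite set) of unit square cells of the square grid. It is convex if along any row of cells and along any column of cells there is no hole. It is intersection free if any two of its rows are comparable, i.e. one row can be embedded in the other by applying a vertical shift. A moon polyomino is a convex and intersection free polyomino. Its rows are labelled $1,\ldots,s$ from top to bottom and its columns $1,\ldots,t$ from left to right; $R_i$ is the row labelled $i$ and $r_i$ its length (number of cells). Order on rows: the sequence $(r_1,\ldots,r_s)$ is unimodal, so there is a unique $i_0$ with $r_1\le r_2\le\cdots\le r_{i_0}>r_{i_0+1}\ge\cdots\ge r_s$ (if $i_0=s$ the second part is void). Let $Up(T)=\{R_i:1\le i\le i_0\}$ and $Low(T)=\{R_i:i_0+1\le i\le s\}$. The total order $\prec$ on the rows is defined by $R_i\prec R_j$ if and only if: $r_i<r_j$; or $r_i=r_j$, $R_i\in Up(T)$ and $R_j\in Low(T)$; or $r_i=r_j$, $R_i,R_j\in Up(T)$ and $R_i$ is above $R_j$; or $r_i=r_j$, $R_i,R_j\in Low(T)$ and $R_i$ is below $R_j$. A $01$-filling $F$ of $T$ assigns $0$ or $1$ to each cell of $T$; a column is empty if all its cells are assigned $0$, and $\mathrm{EC}(F)$ is the set of labels of the empty columns of $F$. $\mathcal{N}(T,\mathbf{m};A)$ is the set of $01$-fillings $F$ of $T$ with exactly $m_i$ $1$'s in row $i$ for each $i$, at most one $1$ in each column, and $\mathrm{EC}(F)=A$. An ascent (resp. descent) of $F$ is a set of two $1$'s of $F$ such that one of them is above and to the right (resp. below and to the right) of the other and the smallest rectangle containing the two $1$'s is contained in $T$.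 $\mathrm{ne}_2(F)$ and $\mathrm{se}_2(F)$ denote the numbers of ascents and of descents of $F$. $p,q$-Gaussian coefficients: $[r]_{p,q}=\frac{p^r-q^r}{p-q}=p^{r-1}+p^{r-2}q+\cdots+q^{r-1}$, $[r]_{p,q}!=\prod_{i=1}^r[i]_{p,q}$, and $\left[{n\atop k}\right]_{p,q}=\frac{[n]_{p,q}!}{[k]_{p,q}!\,[n-k]_{p,q}!}$, with the usual convention that $\left[{n\atop k}\right]_{p,q}=0$ and $\binom{n}{k}=0$ when $k\ge 0$ and $n<k$.
   Formalization: The hypothesis t ≤ m_1+…+m_s+|A| is added; without it the claim fails: for T one row of 3 cells, m_1=1, A=∅, the set N(T,m;A) is empty but the product is [3 choose 1]_{p,q}≠0. In the excluded case N(T,m;A) is always empty. *)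

theory Defs
  imports "HOL-Computational_Algebra.Polynomial" "HOL-Library.FuncSet"
begin

text \<open>
  A cell is a pair (row label, column label), as for matrices: rows are numbered from top to
  bottom and columns from left to right, so a smaller first component means higher up.
\<close>

type_synonym cell = "nat \<times> nat"

subsection \<open>Moon polyominoes\<close>

definition row_cols :: "cell set \<Rightarrow> nat \<Rightarrow> nat set" where
  "row_cols T i = {c. (i, c) \<in> T}"

definition row_len :: "cell set \<Rightarrow> nat \<Rightarrow> nat" where
  "row_len T i = card (row_cols T i)"

definition convex_polyomino :: "cell set \<Rightarrow> bool" where
  "convex_polyomino T \<longleftrightarrow>
     (\<forall>i c d e. (i, c) \<in> T \<and> (i, e) \<in> T \<and> c \<le> d \<and> d \<le> e \<longrightarrow> (i, d) \<in> T) \<and>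
     (\<forall>c i j k. (i, c) \<in> T \<and> (k, c) \<in> T \<and> i \<le> j \<and> j \<le> k \<longrightarrow> (j, c) \<in> T)"

text \<open>
  A row embeds in another one by a vertical shift iff its set of column labels is contained in
  that of the other row.
\<close>

definition intersection_free :: "cell set \<Rightarrow> bool" where
  "intersection_free T \<longleftrightarrow>
     (\<forall>i j. row_cols T i \<subseteq> row_cols T j \<or> row_cols T j \<subseteq> row_cols T i)"

definition moon_polyomino :: "cell set \<Rightarrow> bool" where
  "moon_polyomino T \<longleftrightarrow> finite T \<and> convex_polyomino T \<and> intersection_free T"

subsection \<open>The order on the rows\<close>

text \<open>
  The index \<open>i\<^sub>0\<close> with \<open>r\<^sub>1 \<le> \<dots> \<le> r\<^sub>i\<^sub>0 > r\<^sub>i\<^sub>0\<^sub>+\<^sub>1 \<ge> \<dots> \<ge> r\<^sub>s\<close>;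
  it exists and is unique for a moon polyomino with rows \<open>1, \<dots>, s\<close>, \<open>s \<ge> 1\<close>.
\<close>

definition peak :: "cell set \<Rightarrow> nat \<Rightarrow> nat" where
  "peak T s = (THE i0. 1 \<le> i0 \<and> i0 \<le> s \<and>
     (\<forall>i. 1 \<le> i \<and> i < i0 \<longrightarrow> row_len T i \<le> row_len T (i + 1)) \<and>
     (i0 < s \<longrightarrow> row_len T i0 > row_len T (i0 + 1)) \<and>
     (\<forall>i. i0 + 1 \<le> i \<and> i < s \<longrightarrow> row_len T i \<ge> row_len T (i + 1)))"

definition Up :: "cell set \<Rightarrow> nat \<Rightarrow> nat set" where
  "Up T s = {1..peak T s}"

definition Low :: "cell set \<Rightarrow> nat \<Rightarrow> nat set" where
  "Low T s = {peak T s + 1..s}"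

definition row_less :: "cell set \<Rightarrow> nat \<Rightarrow> nat \<Rightarrow> nat \<Rightarrow> bool" where
  "row_less T s i j \<longleftrightarrow>
     row_len T i < row_len T j \<or>
     (row_len T i = row_len T j \<and>
       ((i \<in> Up T s \<and> j \<in> Low T s) \<or>
        (i \<in> Up T s \<and> j \<in> Up T s \<and> i < j) \<or>
        (i \<in> Low T s \<and> j \<in> Low T s \<and> i > j)))"

subsection \<open>Fillings\<close>

text \<open>
  Fillings are extensional functions on \<^term>\<open>T\<close>, so that a set of fillings contains each
  assignment of values to the cells exactly once.
\<close>

type_synonym filling = "cell \<Rightarrow> nat"

definition fillings01 :: "cell set \<Rightarrow> filling set" where
  "fillings01 T = T \<rightarrow>\<^sub>E {0, 1}"

definition ones :: "cell set \<Rightarrow> filling \<Rightarrow> cell set" where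
  "ones T F = {x \<in> T. F x = 1}"

definition EC :: "cell set \<Rightarrow> filling \<Rightarrow> nat set" where
  "EC T F = {c \<in> snd ` T. \<forall>i. (i, c) \<in> T \<longrightarrow> F (i, c) = 0}"

definition NF :: "cell set \<Rightarrow> (nat \<Rightarrow> nat) \<Rightarrow> nat set \<Rightarrow> filling set" where
  "NF T m A = {F \<in> fillings01 T.
     (\<forall>i \<in> fst ` T. card {x \<in> ones T F. fst x = i} = m i) \<and>
     (\<forall>c \<in> snd ` T. card {x \<in> ones T F. snd x = c} \<le> 1) \<and>
     EC T F = A}"

definition rectangle :: "cell \<Rightarrow> cell \<Rightarrow> cell set" where
  "rectangle x y =
     {min (fst x) (fst y)..max (fst x) (fst y)} \<times> {min (snd x) (snd y)..max (snd x) (snd y)}"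

definition ascents :: "cell set \<Rightarrow> filling \<Rightarrow> cell set set" where
  "ascents T F = {{x, y} | x y. x \<in> ones T F \<and> y \<in> ones T F \<and>
     fst x < fst y \<and> snd x > snd y \<and> rectangle x y \<subseteq> T}"

definition descents :: "cell set \<Rightarrow> filling \<Rightarrow> cell set set" where
  "descents T F = {{x, y} | x y. x \<in> ones T F \<and> y \<in> ones T F \<and>
     fst x > fst y \<and> snd x > snd y \<and> rectangle x y \<subseteq> T}"

definition ne2 :: "cell set \<Rightarrow> filling \<Rightarrow> nat" where
  "ne2 T F = card (ascents T F)"

definition se2 :: "cell set \<Rightarrow> filling \<Rightarrow> nat" where
  "se2 T F = card (descents T F)"

subsection \<open>Gaussian and binomial coefficients with integer upper argument\<close>

definition pq_int :: "'a::comm_ring_1 \<Rightarrow> 'a \<Rightarrow> nat \<Rightarrow> 'a" where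
  "pq_int p q r = (\<Sum>i<r. p ^ (r - 1 - i) * q ^ i)"

definition pq_fact :: "'a::comm_ring_1 \<Rightarrow> 'a \<Rightarrow> nat \<Rightarrow> 'a" where
  "pq_fact p q r = (\<Prod>i=1..r. pq_int p q i)"

text \<open>
  Used below only for the indeterminates \<open>p\<close>, \<open>q\<close> of \<open>\<int>[p,q]\<close>, where the denominator is nonzero
  and divides the numerator, so that \<open>div\<close> is the exact quotient.
\<close>

definition pq_binomial :: "'a::idom_divide \<Rightarrow> 'a \<Rightarrow> int \<Rightarrow> nat \<Rightarrow> 'a" where
  "pq_binomial p q n k =
     (if n < int k then 0
      else pq_fact p q (nat n) div (pq_fact p q k * pq_fact p q (nat n - k)))"

text \<open>
  Unlike \<open>gchoose\<close>, this vanishes for every negative upper argument.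
\<close>

definition binomial_int :: "int \<Rightarrow> nat \<Rightarrow> nat" where
  "binomial_int n k = (if n < int k then 0 else nat n choose k)"

text \<open>The two indeterminates of \<open>\<int>[p,q]\<close>, realised as \<open>\<int>[p][q]\<close>.\<close>

definition var_p :: "int poly poly" where
  "var_p = [:[:0, 1:]:]"

definition var_q :: "int poly poly" where
  "var_q = [:0, 1:]"

end

theory Submission
  imports Defs
begin

text \<open>
  Fill the rows in the order \<open>\<prec>\<close>, each of which contains all its predecessors. The columns of
  row \<open>i\<^sub>j\<close> that are still free and not in \<open>A\<close> are \<open>h\<^sub>i\<^sub>j\<close> in number, whatever the choices made
  before, and \<open>m\<^sub>i\<^sub>j\<close> of them are chosen. The free columns of this row that are not chosen all
  receive their 1 in a later row. The later rows lie all below row \<open>i\<^sub>j\<close> if it belongs to \<open>Up\<close>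
  and all above it if it belongs to \<open>Low\<close>, and a pair of 1's spans a rectangle inside the
  polyomino iff the earlier of the two rows meets both columns. So the ascents and descents
  whose earlier 1 is in row \<open>i\<^sub>j\<close> correspond to the pairs of a chosen and an unchosen free column,
  and their distribution over the choices in this row is a Gaussian coefficient.
\<close>

section \<open>Gaussian coefficients as generating functions of subsets\<close>

text \<open>The p,q-Pascal recurrence, a division-free form of the Gaussian coefficient. The
  truncated exponent \<open>n - k\<close> is harmless: for \<open>n < k\<close> the factor
  \<open>gauss p q n k\<close> is 0.\<close>

fun gauss :: "'a::comm_ring_1 \<Rightarrow> 'a \<Rightarrow> nat \<Rightarrow> nat \<Rightarrow> 'a" where
  "gauss p q n 0 = 1"
| "gauss p q 0 (Suc k) = 0"
| "gauss p q (Suc n) (Suc k) = p ^ (n - k) * gauss p q n k + q ^ Suc k * gauss p q n (Suc k)"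

lemma gauss_eq_0: "n < k \<Longrightarrow> gauss p q n k = 0"
  by (induction p q n k rule: gauss.induct) auto

text \<open>Of the \<open>a + b\<close> monomials, the first \<open>b\<close> carry the factor
  \<open>p ^ a\<close> and the other \<open>a\<close> the factor \<open>q ^ b\<close>. The induction
  on \<open>b\<close> splits off one monomial at a time.\<close>

lemma pq_int_add: "pq_int p q (a + b) = p ^ a * pq_int p q b + q ^ b * pq_int p q a"
proof (induction b)
  case 0
  then show ?case by (simp add: pq_int_def)
next
  case (Suc b)
  have S: "pq_int p q (Suc n) = p * pq_int p q n + q ^ n" for n
  proof -
    have "pq_int p q (Suc n) = (\<Sum>i<n. p ^ (n - i) * q ^ i) + q ^ n"
      by (simp add: pq_int_def)
    also have "(\<Sum>i<n. p ^ (n - i) * q ^ i) = (\<Sum>i<n. p * (p ^ (n - 1 - i) * q ^ i))"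
    proof (rule sum.cong)
      fix i assume "i \<in> {..<n}"
      then have "n - i = Suc (n - 1 - i)" by auto
      then show "p ^ (n - i) * q ^ i = p * (p ^ (n - 1 - i) * q ^ i)"
        by (simp add: mult.assoc)
    qed simp
    finally show ?thesis by (simp add: pq_int_def sum_distrib_left)
  qed
  \<comment> \<open>The identity (p - q) [n] = p^n - q^n without subtraction. It trades the factor
    \<open>p\<close> on \<open>pq_int p q a\<close> for a factor \<open>q\<close>.\<close>
  have C: "pq_int p q n * p + q ^ n = pq_int p q n * q + p ^ n" for n
  proof (induction n)
    case 0
    then show ?case by (simp add: pq_int_def)
  next
    case (Suc n)
    have X: "pq_int p q (Suc n) = q * pq_int p q n + p ^ n"
      using Suc.IH S by (simp add: mult.commute)
    have "pq_int p q (Suc n) * p + q ^ Suc n = q * pq_int p q (Suc n) + p ^ Suc n"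
      by (subst X, subst S) (simp add: algebra_simps)
    then show ?case by (simp add: mult.commute)
  qed
  have "pq_int p q (a + Suc b) = p * (p ^ a * pq_int p q b + q ^ b * pq_int p q a) + q ^ (a + b)"
    using S[of "a + b"] Suc by simp
  also have "\<dots> = p ^ a * (p * pq_int p q b) + q ^ b * (pq_int p q a * p + q ^ a)"
    by (simp add: algebra_simps power_add)
  also have "\<dots> = p ^ a * pq_int p q (Suc b) + q ^ Suc b * pq_int p q a"
    unfolding C S by (simp add: algebra_simps)
  finally show ?case .
qed

lemma pq_fact_Suc: "pq_fact p q (Suc n) = pq_fact p q n * pq_int p q (Suc n)"
  by (simp add: pq_fact_def)

text \<open>Multiplied by the factorials, the two terms of the Pascal recurrence become p^(n-l)
  [l+1] and q^(l+1) [n-l] times [n]!. By \<open>pq_int_add\<close> these two coefficients add up to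
  [n+1].\<close>

lemma gauss_mult_pq_fact:
  "k \<le> n \<Longrightarrow> gauss p q n k * (pq_fact p q k * pq_fact p q (n - k)) = pq_fact p q n"
proof (induction n arbitrary: k)
  case 0
  then show ?case by (simp add: pq_fact_def)
next
  case (Suc n)
  show ?case
  proof (cases k)
    case 0
    then show ?thesis by (simp add: pq_fact_def)
  next
    case k: (Suc l)
    have ln: "l \<le> n" using Suc.prems k by simp
    have 1: "gauss p q n l * (pq_fact p q l * pq_fact p q (n - l)) = pq_fact p q n"
      by (rule Suc.IH[OF ln])
    have 2: "gauss p q n (Suc l) * (pq_fact p q (Suc l) * pq_fact p q (n - l))
               = pq_int p q (n - l) * pq_fact p q n"
    proof (cases "l = n")
      case True
      then show ?thesis by (simp add: gauss_eq_0 pq_int_def)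
    next
      case False
      then obtain d where d: "n - l = Suc d" "n - Suc l = d" "Suc l \<le> n"
        using ln by (metis Suc_diff_Suc Suc_leI le_neq_implies_less)
      show ?thesis using Suc.IH[OF d(3)] unfolding d pq_fact_Suc[of _ _ d]
        by (metis (no_types, opaque_lifting) mult.commute mult.left_commute)
    qed
    have "gauss p q (Suc n) (Suc l) * (pq_fact p q (Suc l) * pq_fact p q (n - l))
        = p ^ (n - l) * pq_int p q (Suc l) * (gauss p q n l * (pq_fact p q l * pq_fact p q (n - l)))
          + q ^ Suc l * (gauss p q n (Suc l) * (pq_fact p q (Suc l) * pq_fact p q (n - l)))"
      by (simp add: algebra_simps pq_fact_Suc)
    also have "\<dots> = (p ^ (n - l) * pq_int p q (Suc l) + q ^ Suc l * pq_int p q (n - l)) * pq_fact p q n"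
      unfolding 1 2 by (simp add: algebra_simps)
    also have "\<dots> = pq_int p q (Suc n) * pq_fact p q n"
      using pq_int_add[of p q "n - l" "Suc l"] ln by simp
    finally show ?thesis by (simp add: k pq_fact_Suc mult.commute)
  qed
qed

text \<open>Nonzero brackets make the denominator nonzero in an integral domain, so
  \<open>div\<close> cancels it exactly.\<close>

lemma pq_binomial_eq_gauss:
  assumes "\<And>n. n > 0 \<Longrightarrow> pq_int p q n \<noteq> 0"
  shows "pq_binomial p q (int n) k = gauss p q n k"
proof (cases "n < k")
  case True
  then show ?thesis by (simp add: pq_binomial_def gauss_eq_0)
next
  case False
  have "pq_fact p q n \<noteq> 0" for n
    using assms by (auto simp: pq_fact_def)
  with False show ?thesis
    by (simp add: pq_binomial_def flip: gauss_mult_pq_fact[of k n p q])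
qed

lemma pq_int_commute: "pq_int p q n = pq_int q p n"
  unfolding pq_int_def
  by (subst sum.nat_diff_reindex[symmetric]) (auto intro!: sum.cong simp: mult.commute)

text \<open>This symmetry serves the rows in \<open>Low\<close>, where \<open>p\<close> and
  \<open>q\<close> exchange roles.\<close>

lemma pq_binomial_commute: "pq_binomial p q = pq_binomial q p"
  by (intro ext) (simp add: pq_binomial_def pq_fact_def pq_int_commute[of p q])

text \<open>Setting both indeterminates to 1 turns the bracket into the integer
  \<open>n\<close>.\<close>

lemma pq_int_vars_nonzero:
  assumes "n > 0"
  shows "pq_int var_p var_q n \<noteq> 0"
proof
  assume "pq_int var_p var_q n = 0"
  then have "poly (poly (pq_int var_p var_q n) 1) 1 = 0" by simp
  moreover have "poly (poly (pq_int var_p var_q n) 1) 1 = int n"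
    by (simp add: pq_int_def var_p_def var_q_def poly_sum)
  ultimately show False using assms by simp
qed

text \<open>In the application \<open>V\<close> holds the columns still open to a row and
  \<open>S\<close> those that receive its 1's. Left and right describe the unchosen \<open>d\<close>
  relative to the chosen \<open>c\<close>.\<close>

definition left_pairs :: "'a::linorder set \<Rightarrow> 'a set \<Rightarrow> ('a \<times> 'a) set" where
  "left_pairs S V = {(c, d). c \<in> S \<and> d \<in> V - S \<and> d < c}"

definition right_pairs :: "'a::linorder set \<Rightarrow> 'a set \<Rightarrow> ('a \<times> 'a) set" where
  "right_pairs S V = {(c, d). c \<in> S \<and> d \<in> V - S \<and> c < d}"

lemma finite_pairs [simp]:
  assumes "finite V" "S \<subseteq> V"
  shows "finite (left_pairs S V)" "finite (right_pairs S V)"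
proof -
  have "finite (V \<times> V)" using assms by simp
  then show "finite (left_pairs S V)" "finite (right_pairs S V)"
    by (rule rev_finite_subset, use assms in \<open>auto simp: left_pairs_def right_pairs_def\<close>)+
qed

text \<open>A chosen maximum has every unchosen element on its left and nothing on its
  right.\<close>

lemma card_pairs_insert_chosen:
  assumes "finite V" "S \<subseteq> V" "\<And>w. w \<in> V \<Longrightarrow> w < v"
  shows "card (left_pairs (insert v S) (insert v V)) = card V - card S + card (left_pairs S V)"
    and "card (right_pairs (insert v S) (insert v V)) = card (right_pairs S V)"
proof -
  have "v \<notin> V" using assms(3) by blast
  have L: "left_pairs (insert v S) (insert v V) = Pair v ` (V - S) \<union> left_pairs S V"
    using assms \<open>v \<notin> V\<close> by (auto simp: left_pairs_def)
  have "card (left_pairs (insert v S) (insert v V)) = card (Pair v ` (V - S)) + card (left_pairs S V)"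
    unfolding L using assms \<open>v \<notin> V\<close>
    by (intro card_Un_disjoint finite_pairs) (auto simp: left_pairs_def)
  then show "card (left_pairs (insert v S) (insert v V)) = card V - card S + card (left_pairs S V)"
    using assms by (simp add: card_image inj_on_def card_Diff_subset finite_subset)
  show "card (right_pairs (insert v S) (insert v V)) = card (right_pairs S V)"
    by (rule arg_cong[of _ _ card])
       (use assms \<open>v \<notin> V\<close> in \<open>auto simp: right_pairs_def dest: order.asym\<close>)
qed

lemma card_pairs_insert_unchosen:
  assumes "finite V" "S \<subseteq> V" "\<And>w. w \<in> V \<Longrightarrow> w < v"
  shows "card (left_pairs S (insert v V)) = card (left_pairs S V)"
    and "card (right_pairs S (insert v V)) = card S + card (right_pairs S V)"
proof -
  have "v \<notin> V" using assms(3) by blast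
  have R: "right_pairs S (insert v V) = (\<lambda>c. (c, v)) ` S \<union> right_pairs S V"
    using assms \<open>v \<notin> V\<close> by (auto simp: right_pairs_def)
  have "finite S" using assms finite_subset by blast
  then have "card (right_pairs S (insert v V)) = card ((\<lambda>c. (c, v)) ` S) + card (right_pairs S V)"
    unfolding R using assms \<open>v \<notin> V\<close>
    by (intro card_Un_disjoint finite_pairs) (auto simp: right_pairs_def)
  then show "card (right_pairs S (insert v V)) = card S + card (right_pairs S V)"
    by (simp add: card_image inj_on_def)
  show "card (left_pairs S (insert v V)) = card (left_pairs S V)"
    by (rule arg_cong[of _ _ card])
       (use assms \<open>v \<notin> V\<close> in \<open>auto simp: left_pairs_def dest: order.asym\<close>)
qed

text \<open>Adding maxima one by one, the \<open>k\<close>-subsets split by the new maximum: those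
  avoiding it gain the factor \<open>q ^ k\<close>, those consisting of it and
  \<open>l = k - 1\<close> others gain \<open>p ^ (card V - l)\<close>. This is the recurrence of
  \<open>gauss\<close>.\<close>

lemma sum_pairs_eq_gauss:
  fixes V :: "'b::linorder set" and p q :: "'a::comm_ring_1"
  assumes "finite V"
  shows "(\<Sum>S | S \<subseteq> V \<and> card S = k. p ^ card (left_pairs S V) * q ^ card (right_pairs S V))
           = gauss p q (card V) k"
  using assms
proof (induction V arbitrary: k rule: finite_linorder_max_induct)
  case empty
  have "{S. S \<subseteq> ({}::'b set) \<and> card S = k} = (if k = 0 then {{}} else {})"
    by (auto simp: subset_empty)
  then show ?case
    by (cases k) (simp_all only: if_True if_False, auto simp: left_pairs_def right_pairs_def)
next
  case (insert v V)
  let ?w = "\<lambda>S V. p ^ card (left_pairs S V) * q ^ card (right_pairs S V)"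
  have v: "v \<notin> V" using insert.hyps by blast
  have fin: "finite {S. S \<subseteq> V \<and> P S}" for P using insert.hyps by simp
  have finS: "finite S" if "S \<subseteq> V" for S using that insert.hyps finite_subset by blast
  show ?case
  proof (cases k)
    case 0
    have "{S. S \<subseteq> insert v V \<and> card S = k} = {{}}"
      using 0 insert.hyps finite_subset by fastforce
    then show ?thesis using 0 by (simp add: left_pairs_def right_pairs_def)
  next
    case k: (Suc l)
    have split: "{S. S \<subseteq> insert v V \<and> card S = k}
      = {S. S \<subseteq> V \<and> card S = k} \<union> insert v ` {S. S \<subseteq> V \<and> card S = l}" (is "?X = ?Y \<union> ?Z")
    proof (intro equalityI subsetI)
      fix S assume S: "S \<in> ?X"
      show "S \<in> ?Y \<union> ?Z"
      proof (cases "v \<in> S")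
        case True
        have "finite S" using S insert.hyps by (auto intro: finite_subset)
        then have "S - {v} \<subseteq> V \<and> card (S - {v}) = l" using S True k by auto
        then show ?thesis using True by (metis (mono_tags, lifting) UnI2 image_eqI insert_Diff mem_Collect_eq)
      qed (use S in auto)
    next
      fix S assume "S \<in> ?Y \<union> ?Z"
      then show "S \<in> ?X" using v k finS by (auto simp: card_insert_if)
    qed
    have inj: "inj_on (insert v) {S. S \<subseteq> V \<and> card S = l}"
      using v by (auto simp: inj_on_def)
    have "(\<Sum>S\<in>?X. ?w S (insert v V))
        = (\<Sum>S\<in>?Y. ?w S (insert v V)) + (\<Sum>S\<in>?Z. ?w S (insert v V))"
      unfolding split using v fin by (intro sum.union_disjoint) auto
    also have "(\<Sum>S\<in>?Y. ?w S (insert v V)) = (\<Sum>S\<in>?Y. q ^ k * ?w S V)"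
      using insert.hyps by (intro sum.cong) (auto simp: card_pairs_insert_unchosen power_add mult_ac)
    also have "\<dots> = q ^ k * gauss p q (card V) k"
      using insert.IH[of k] by (simp flip: sum_distrib_left)
    also have "(\<Sum>S\<in>?Z. ?w S (insert v V)) = (\<Sum>S | S \<subseteq> V \<and> card S = l. p ^ (card V - l) * ?w S V)"
      using insert.hyps unfolding sum.reindex[OF inj]
      by (intro sum.cong) (auto simp: card_pairs_insert_chosen power_add mult_ac)
    also have "\<dots> = p ^ (card V - l) * gauss p q (card V) l"
      using insert.IH[of l] by (simp flip: sum_distrib_left)
    finally show ?thesis using v k insert.hyps by (simp add: add.commute)
  qed
qed

section \<open>Placing the ones row by row\<close>

text \<open>The index \<open>j\<close> is a position in the filling order, not a row label;
  \<open>B j\<close> holds the columns permitted at that position.\<close>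

definition avail :: "(nat \<Rightarrow> 'a set) \<Rightarrow> (nat \<Rightarrow> 'a set) \<Rightarrow> nat \<Rightarrow> 'a set" where
  "avail B S j = B j - (\<Union>l\<in>{1..<j}. S l)"

text \<open>Fixing \<open>S j = {}\<close> outside the positions makes each family of choices a
  single function, so that sums count it once.\<close>

definition placements :: "(nat \<Rightarrow> 'a set) \<Rightarrow> (nat \<Rightarrow> nat) \<Rightarrow> nat \<Rightarrow> (nat \<Rightarrow> 'a set) set" where
  "placements B m n = {S. (\<forall>j\<in>{1..n}. S j \<subseteq> avail B S j \<and> card (S j) = m j) \<and>
     (\<forall>j. j \<notin> {1..n} \<longrightarrow> S j = {})}"

lemma avail_upd: "j \<le> n \<Longrightarrow> avail B (S(n := U)) j = avail B S j"
  by (auto simp: avail_def)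

text \<open>The constraint at a position looks only at earlier ones, so a choice at position
  \<open>Suc n\<close> leaves the previous constraints intact. Resetting that position to
  \<open>{}\<close> is the inverse.\<close>

lemma bij_betw_placements_Suc:
  "bij_betw (\<lambda>(S, U). S(Suc n := U))
     (SIGMA S:placements B m n. {U. U \<subseteq> avail B S (Suc n) \<and> card U = m (Suc n)})
     (placements B m (Suc n))"
proof (rule bij_betwI[where g = "\<lambda>S. (S(Suc n := {}), S (Suc n))"])
  show "(\<lambda>(S, U). S(Suc n := U))
    \<in> (SIGMA S:placements B m n. {U. U \<subseteq> avail B S (Suc n) \<and> card U = m (Suc n)})
      \<rightarrow> placements B m (Suc n)"
  proof safe
    fix S U
    assume S: "S \<in> placements B m n" and U: "U \<subseteq> avail B S (Suc n)" "card U = m (Suc n)"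
    have "(S(Suc n := U)) j \<subseteq> avail B (S(Suc n := U)) j \<and> card ((S(Suc n := U)) j) = m j"
      if "j \<in> {1..Suc n}" for j
    proof (cases "j = Suc n")
      case True
      then show ?thesis using U by (simp add: avail_upd)
    next
      case False
      then show ?thesis using S that by (simp add: avail_upd placements_def)
    qed
    then show "S(Suc n := U) \<in> placements B m (Suc n)"
      using S by (auto simp: placements_def)
  qed
next
  show "(\<lambda>S. (S(Suc n := {}), S (Suc n))) \<in> placements B m (Suc n)
    \<rightarrow> (SIGMA S:placements B m n. {U. U \<subseteq> avail B S (Suc n) \<and> card U = m (Suc n)})"
  proof
    fix S assume S: "S \<in> placements B m (Suc n)"
    then have "S(Suc n := {}) \<in> placements B m n"
      by (simp add: placements_def avail_upd le_Suc_eq)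
    moreover have "S (Suc n) \<subseteq> avail B (S(Suc n := {})) (Suc n) \<and> card (S (Suc n)) = m (Suc n)"
      using S by (simp add: placements_def avail_upd)
    ultimately show "(S(Suc n := {}), S (Suc n))
      \<in> (SIGMA S:placements B m n. {U. U \<subseteq> avail B S (Suc n) \<and> card U = m (Suc n)})"
      by simp
  qed
next
  fix x assume "x \<in> (SIGMA S:placements B m n. {U. U \<subseteq> avail B S (Suc n) \<and> card U = m (Suc n)})"
  then show "(\<lambda>S. (S(Suc n := {}), S (Suc n))) ((\<lambda>(S, U). S(Suc n := U)) x) = x"
    by (auto simp: placements_def fun_eq_iff)
qed auto

lemma finite_placements:
  assumes "\<And>j. j \<in> {1..n} \<Longrightarrow> finite (B j)"
  shows "finite (placements B m n)"
  using assms
proof (induction n)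
  case 0
  have "placements B m 0 = {\<lambda>_. {}}" by (auto simp: placements_def)
  then show ?case by simp
next
  case (Suc n)
  have "finite (SIGMA S:placements B m n. {U. U \<subseteq> avail B S (Suc n) \<and> card U = m (Suc n)})"
    using Suc by (intro finite_SigmaI) (auto simp: avail_def)
  then show ?case using bij_betw_finite[OF bij_betw_placements_Suc[of n B m]] by blast
qed

lemma placements_disjoint:
  assumes "S \<in> placements B m n" "j \<noteq> k"
  shows "S j \<inter> S k = {}"
proof -
  have "S k \<inter> S j = {}" if "j < k" for j k
    using assms(1) that by (cases "j \<in> {1..n} \<and> k \<in> {1..n}") (force simp: placements_def avail_def)+
  then show ?thesis using assms(2) by (metis inf_commute nat_neq_iff)
qed

lemma card_UN_placements:
  assumes "S \<in> placements B m n" "\<And>j. j \<in> {1..n} \<Longrightarrow> finite (B j)" "J \<subseteq> {1..n}"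
  shows "card (\<Union>j\<in>J. S j) = (\<Sum>j\<in>J. m j)"
proof -
  have sub: "S j \<subseteq> B j" "card (S j) = m j" if "j \<in> J" for j
    using assms that by (auto simp: placements_def avail_def)
  have "card (\<Union>j\<in>J. S j) = (\<Sum>j\<in>J. card (S j))"
  proof (rule card_UN_disjoint)
    show "finite J" using assms(3) finite_subset by blast
    show "\<forall>j\<in>J. finite (S j)" using sub assms(2,3) finite_subset by blast
    show "\<forall>j\<in>J. \<forall>k\<in>J. j \<noteq> k \<longrightarrow> S j \<inter> S k = {}" using placements_disjoint[OF assms(1)] by blast
  qed
  then show ?thesis using sub by simp
qed

text \<open>Since the sets \<open>B j\<close> increase, all earlier choices lie inside the current
  one, and the number of available elements depends on \<open>m\<close> alone. The sum over the last
  choice is then the same for every earlier placement and factors out.\<close>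

lemma sum_placements:
  fixes W :: "nat \<Rightarrow> 'a set \<Rightarrow> 'a set \<Rightarrow> 'b::comm_semiring_1"
  assumes "\<And>j. j \<in> {1..n} \<Longrightarrow> finite (B j)"
    and "\<And>j k. 1 \<le> j \<Longrightarrow> j < k \<Longrightarrow> k \<le> n \<Longrightarrow> B j \<subseteq> B k"
    and "\<And>j V. finite V \<Longrightarrow> (\<Sum>U | U \<subseteq> V \<and> card U = m j. W j U V) = G (int (card V)) (m j)"
  shows "(\<Sum>S\<in>placements B m n. \<Prod>j=1..n. W j (S j) (avail B S j))
           = (\<Prod>j=1..n. G (int (card (B j)) - int (\<Sum>l\<in>{1..<j}. m l)) (m j))"
  using assms
proof (induction n)
  case 0
  have "placements B m 0 = {\<lambda>_. {}}" by (auto simp: placements_def)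
  then show ?case by simp
next
  case (Suc n)
  let ?P = "placements B m n"
  let ?C = "\<lambda>S. {U. U \<subseteq> avail B S (Suc n) \<and> card U = m (Suc n)}"
  let ?w = "\<lambda>n S. \<Prod>j=1..n. W j (S j) (avail B S j)"
  let ?g = "\<lambda>j. G (int (card (B j)) - int (\<Sum>l\<in>{1..<j}. m l)) (m j)"
  have finB: "finite (B (Suc n))" using Suc.prems by simp
  have finP: "finite ?P" using Suc.prems by (intro finite_placements) auto
  have inner: "(\<Sum>U\<in>?C S. W (Suc n) U (avail B S (Suc n))) = ?g (Suc n)" if S: "S \<in> ?P" for S
  proof -
    have "S j \<subseteq> B (Suc n)" if "j \<in> {1..<Suc n}" for j
    proof -
      have "S j \<subseteq> B j" using S that by (auto simp: placements_def avail_def)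
      then show ?thesis using Suc.prems(2)[of j "Suc n"] that by auto
    qed
    then have sub: "(\<Union>j\<in>{1..<Suc n}. S j) \<subseteq> B (Suc n)" by blast
    have c: "card (\<Union>j\<in>{1..<Suc n}. S j) = (\<Sum>l\<in>{1..<Suc n}. m l)"
      using Suc.prems by (intro card_UN_placements[OF S]) auto
    have "card (avail B S (Suc n)) = card (B (Suc n)) - (\<Sum>l\<in>{1..<Suc n}. m l)"
      unfolding avail_def c[symmetric] by (rule card_Diff_subset[OF finite_subset[OF sub finB] sub])
    moreover have "(\<Sum>l\<in>{1..<Suc n}. m l) \<le> card (B (Suc n))"
      using card_mono[OF finB sub] c by simp
    ultimately have "int (card (avail B S (Suc n))) = int (card (B (Suc n))) - int (\<Sum>l\<in>{1..<Suc n}. m l)"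
      by linarith
    moreover have "finite (avail B S (Suc n))" using finB by (simp add: avail_def)
    ultimately show ?thesis using Suc.prems(3) by presburger
  qed
  have "(\<Sum>S\<in>placements B m (Suc n). ?w (Suc n) S)
      = (\<Sum>(S, U)\<in>Sigma ?P ?C. ?w (Suc n) (S(Suc n := U)))"
    by (subst sum.reindex_bij_betw[OF bij_betw_placements_Suc, symmetric]) (simp add: case_prod_beta)
  also have "\<dots> = (\<Sum>(S, U)\<in>Sigma ?P ?C. ?w n S * W (Suc n) U (avail B S (Suc n)))"
    by (intro sum.cong refl) (auto simp: avail_upd intro!: arg_cong2[of _ _ _ _ "(*)"] prod.cong)
  also have "\<dots> = (\<Sum>S\<in>?P. \<Sum>U\<in>?C S. ?w n S * W (Suc n) U (avail B S (Suc n)))"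
    using finP finB by (subst sum.Sigma) (auto simp: avail_def)
  also have "\<dots> = (\<Sum>S\<in>?P. ?w n S * ?g (Suc n))"
    by (intro sum.cong refl) (simp only: inner flip: sum_distrib_left)
  \<comment> \<open>A negative argument of \<open>G\<close> at the last position occurs only if
    \<open>?P\<close> is empty; by the induction hypothesis the earlier factors then multiply to
    0.\<close>
  also have "\<dots> = (\<Prod>j=1..n. ?g j) * ?g (Suc n)"
    using Suc by (simp flip: sum_distrib_right)
  finally show ?case by simp
qed

section \<open>The order on the rows\<close>

locale moon_rows =
  fixes T :: "cell set" and s t :: nat and A :: "nat set" and i :: "nat \<Rightarrow> nat"
  assumes moon: "moon_polyomino T"
    and rows: "fst ` T = {1..s}"
    and cols: "snd ` T = {1..t}"
    and A: "A \<subseteq> {1..t}"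
    and enum: "bij_betw i {1..s} {1..s}"
    and ordered: "\<forall>j\<in>{1..s}. \<forall>k\<in>{1..s}. j < k \<longrightarrow> row_less T s (i j) (i k)"
begin

lemma finite_row_cols: "finite (row_cols T a)"
proof (rule finite_subset)
  show "row_cols T a \<subseteq> snd ` T" by (force simp: row_cols_def)
  show "finite (snd ` T)" using cols by simp
qed

lemma row_cols_mono:
  assumes "row_len T a \<le> row_len T b"
  shows "row_cols T a \<subseteq> row_cols T b"
proof -
  consider "row_cols T a \<subseteq> row_cols T b" | "row_cols T b \<subseteq> row_cols T a"
    using moon unfolding moon_polyomino_def intersection_free_def by blast
  then show ?thesis
  proof cases
    case 2
    then have "row_cols T b = row_cols T a"
      using assms finite_row_cols unfolding row_len_def by (intro card_seteq) auto
    then show ?thesis by simp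
  qed
qed

text \<open>By column convexity row \<open>b\<close> contains the intersection of rows
  \<open>a\<close> and \<open>c\<close>, which is the shorter of these two because they are
  comparable. Unimodality of the lengths rests on this.\<close>

lemma row_len_between:
  assumes "a \<le> b" "b \<le> c"
  shows "min (row_len T a) (row_len T c) \<le> row_len T b"
proof -
  have "row_cols T a \<inter> row_cols T c \<subseteq> row_cols T b"
    using moon assms unfolding moon_polyomino_def convex_polyomino_def row_cols_def by blast
  moreover have "row_cols T a \<inter> row_cols T c = row_cols T (if row_len T a \<le> row_len T c then a else c)"
    using row_cols_mono[of a c] row_cols_mono[of c a] by auto
  ultimately have "row_len T (if row_len T a \<le> row_len T c then a else c) \<le> row_len T b"
    unfolding row_len_def[of T b] by (metis card_mono finite_row_cols row_len_def)
  then show ?thesis by (simp add: min_def split: if_splits)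
qed

section \<open>The peak of the row lengths and the side on which later rows lie\<close>

definition is_peak :: "nat \<Rightarrow> bool" where
  "is_peak i0 \<longleftrightarrow> 1 \<le> i0 \<and> i0 \<le> s \<and>
     (\<forall>i. 1 \<le> i \<and> i < i0 \<longrightarrow> row_len T i \<le> row_len T (i + 1)) \<and>
     (i0 < s \<longrightarrow> row_len T i0 > row_len T (i0 + 1)) \<and>
     (\<forall>i. i0 + 1 \<le> i \<and> i < s \<longrightarrow> row_len T i \<ge> row_len T (i + 1))"

text \<open>Just after the smaller of two peaks the length would have to drop strictly, yet that
  step is still on the ascending side of the larger peak.\<close>

lemma is_peak_unique:
  assumes "is_peak a" "is_peak b"
  shows "a = b"
proof -
  have "\<not> a < b" if "is_peak a" "is_peak b" for a b
  proof
    assume "a < b"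
    then have "row_len T a \<le> row_len T (a + 1)" "row_len T a > row_len T (a + 1)"
      using that unfolding is_peak_def by auto
    then show False by simp
  qed
  then show ?thesis using assms nat_neq_iff by blast
qed

text \<open>The last of the longest rows is the peak.\<close>

lemma ex_is_peak:
  assumes "s \<ge> 1"
  shows "\<exists>a. is_peak a"
proof -
  define M where "M = Max (row_len T ` {1..s})"
  define a where "a = Max {k \<in> {1..s}. row_len T k = M}"
  have "M \<in> row_len T ` {1..s}" unfolding M_def using assms by (intro Max_in) auto
  then have "{k \<in> {1..s}. row_len T k = M} \<noteq> {}" by auto
  then have "a \<in> {k \<in> {1..s}. row_len T k = M}" unfolding a_def by (intro Max_in) auto
  then have a: "1 \<le> a" "a \<le> s" "row_len T a = M" by auto
  have le: "row_len T k \<le> M" if "1 \<le> k" "k \<le> s" for k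
    unfolding M_def using that by (intro Max_ge) auto
  have last: "k \<le> a" if "1 \<le> k" "k \<le> s" "row_len T k = M" for k
    unfolding a_def using that by (intro Max_ge) auto
  have "is_peak a"
    unfolding is_peak_def
  proof (intro conjI allI impI)
    fix k assume k: "1 \<le> k \<and> k < a"
    then show "row_len T k \<le> row_len T (k + 1)"
      using row_len_between[of k "k + 1" a] le[of k] a by simp
  next
    assume "a < s"
    then show "row_len T (a + 1) < row_len T a"
      using le[of "a + 1"] last[of "a + 1"] a by fastforce
  next
    fix k assume k: "a + 1 \<le> k \<and> k < s"
    then show "row_len T (k + 1) \<le> row_len T k"
      using row_len_between[of a k "k + 1"] le[of "k + 1"] a by simp
  qed (use a in auto)
  then show ?thesis ..
qed

lemma is_peak_peak: "s \<ge> 1 \<Longrightarrow> is_peak (peak T s)"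
  unfolding peak_def is_peak_def[symmetric]
  by (rule theI') (use ex_is_peak is_peak_unique in blast)

lemma row_len_mono_Up:
  assumes "1 \<le> a" "a \<le> b" "b \<le> peak T s" "s \<ge> 1"
  shows "row_len T a \<le> row_len T b"
  using assms(2,1,3)
proof (induction rule: dec_induct)
  case (step n)
  have "row_len T n \<le> row_len T (Suc n)"
    using is_peak_peak[OF assms(4)] step unfolding is_peak_def by auto
  then show ?case using step by simp
qed simp

lemma row_len_antimono_Low:
  assumes "peak T s < a" "a \<le> b" "b \<le> s" "s \<ge> 1"
  shows "row_len T b \<le> row_len T a"
  using assms(2,1,3)
proof (induction rule: dec_induct)
  case (step n)
  have "row_len T (Suc n) \<le> row_len T n"
    using is_peak_peak[OF assms(4)] step unfolding is_peak_def by auto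
  then show ?case using step by simp
qed simp

lemma i_in: "j \<in> {1..s} \<Longrightarrow> i j \<in> {1..s}"
  using enum bij_betwE by blast

lemma i_eq_iff: "j \<in> {1..s} \<Longrightarrow> k \<in> {1..s} \<Longrightarrow> i j = i k \<longleftrightarrow> j = k"
  using enum unfolding bij_betw_def inj_on_def by blast

lemma row_cols_chain:
  assumes "1 \<le> j" "j \<le> k" "k \<le> s"
  shows "row_cols T (i j) \<subseteq> row_cols T (i k)"
proof (cases "j = k")
  case False
  then have "row_less T s (i j) (i k)" using ordered assms by simp
  then show ?thesis unfolding row_less_def by (intro row_cols_mono) auto
qed simp

text \<open>A row above \<open>i j\<close> in \<open>Up\<close> is not longer, and ties in
  \<open>Up\<close> favour the upper row, so it precedes; hence all successors of an
  \<open>Up\<close> row lie below it. In \<open>Low\<close> both lengths and tie-breaking are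
  mirrored, and successors lie above.\<close>

lemma later_row_position:
  assumes "1 \<le> j" "j < k" "k \<le> s"
  shows "i j < i k \<longleftrightarrow> i j \<in> Up T s"
proof
  have less: "row_less T s (i j) (i k)" using ordered assms by simp
  have s: "s \<ge> 1" and ij: "1 \<le> i j" "i j \<le> s" and ik: "1 \<le> i k" "i k \<le> s"
    using assms i_in[of j] i_in[of k] by auto
  show "i j \<in> Up T s" if "i j < i k"
  proof (rule ccontr)
    assume "i j \<notin> Up T s"
    then have low: "peak T s < i j" using ij by (auto simp: Up_def)
    then have "row_len T (i k) \<le> row_len T (i j)"
      using row_len_antimono_Low[of "i j" "i k"] that ik s by simp
    then show False using less low that unfolding row_less_def by (auto simp: Up_def)
  qed
  show "i j < i k" if "i j \<in> Up T s"
  proof (rule ccontr)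
    assume "\<not> i j < i k"
    then have le: "i k \<le> i j" by simp
    have up: "i j \<le> peak T s" using that by (simp add: Up_def)
    have "row_len T (i k) \<le> row_len T (i j)"
      using row_len_mono_Up[of "i k" "i j"] up le ik s by simp
    then show False using less up le unfolding row_less_def by (auto simp: Low_def)
  qed
qed

section \<open>Fillings as placements\<close>

definition free_cols :: "nat \<Rightarrow> nat set" where
  "free_cols j = row_cols T (i j) - A"

definition placement :: "filling \<Rightarrow> nat \<Rightarrow> nat set" where
  "placement F j = (if j \<in> {1..s} then {c. (i j, c) \<in> ones T F} else {})"

text \<open>The intended inverse of \<open>placement\<close>; \<open>restrict\<close> supplies the
  default value that extensional fillings take outside \<open>T\<close>.\<close>

definition filling_of :: "(nat \<Rightarrow> nat set) \<Rightarrow> filling" where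
  "filling_of S = restrict (\<lambda>(a, c). if \<exists>j\<in>{1..s}. a = i j \<and> c \<in> S j then 1 else 0) T"

lemma finite_free_cols: "finite (free_cols j)"
  by (simp add: free_cols_def finite_row_cols)

lemma T_range:
  assumes "(a, c) \<in> T"
  shows "a \<in> {1..s}" "c \<in> {1..t}"
  using assms rows cols by (metis fst_conv image_eqI, metis snd_conv image_eqI)

lemma row_cases:
  assumes "(a, c) \<in> T"
  obtains j where "j \<in> {1..s}" "a = i j"
  using T_range(1)[OF assms] enum unfolding bij_betw_def by (metis imageE)

lemma ones_subset: "ones T F \<subseteq> T"
  by (auto simp: ones_def)

lemma finite_T: "finite T"
  using moon by (simp add: moon_polyomino_def)

lemma NF_column_unique:
  assumes F: "F \<in> NF T m A" and "(a, c) \<in> ones T F" "(b, c) \<in> ones T F"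
  shows "a = b"
proof -
  have "c \<in> snd ` T" using assms(2) ones_subset by force
  then have "card {x \<in> ones T F. snd x = c} \<le> Suc 0" using F by (auto simp: NF_def)
  moreover have "finite {x \<in> ones T F. snd x = c}"
    using finite_T ones_subset finite_subset by (metis (no_types, lifting) mem_Collect_eq subsetI)
  ultimately have "(a, c) = (b, c)"
    using assms(2,3) by (metis (mono_tags, lifting) card_le_Suc0_iff_eq mem_Collect_eq snd_conv)
  then show ?thesis by simp
qed

lemma placement_in_placements:
  assumes F: "F \<in> NF T m A"
  shows "placement F \<in> placements free_cols (m \<circ> i) s"
proof -
  have "placement F j \<subseteq> avail free_cols (placement F) j \<and> card (placement F j) = m (i j)"
    if j: "j \<in> {1..s}" for j
  proof
    show "placement F j \<subseteq> avail free_cols (placement F) j"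
    proof
      fix c assume "c \<in> placement F j"
      then have c: "(i j, c) \<in> ones T F" using j by (simp add: placement_def)
      then have cT: "(i j, c) \<in> T" "F (i j, c) = 1" by (auto simp: ones_def)
      then have "c \<notin> EC T F" by (auto simp: EC_def)
      then have "c \<in> free_cols j" using F cT by (auto simp: NF_def free_cols_def row_cols_def)
      moreover have "c \<notin> placement F l" if l: "l \<in> {1..<j}" for l
      proof
        assume "c \<in> placement F l"
        then have "i l = i j" using NF_column_unique[OF F _ c] l j by (auto simp: placement_def)
        then show False using l j i_eq_iff[of l j] by auto
      qed
      ultimately show "c \<in> avail free_cols (placement F) j" by (auto simp: avail_def)
    qed
    have "i j \<in> fst ` T" using i_in[OF j] rows by simp
    then have "card {x \<in> ones T F. fst x = i j} = m (i j)" using F by (auto simp: NF_def)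
    moreover have "{x \<in> ones T F. fst x = i j} = Pair (i j) ` placement F j"
      using j by (auto simp: placement_def)
    ultimately show "card (placement F j) = m (i j)"
      by (simp add: card_image inj_on_def)
  qed
  then show ?thesis by (auto simp: placements_def placement_def)
qed

text \<open>No column is left over, since all columns outside \<open>A\<close> are needed for the 1's.\<close>

lemma UN_placements:
  assumes S: "S \<in> placements free_cols (m \<circ> i) s"
    and enough: "t \<le> (\<Sum>k=1..s. m k) + card A"
  shows "(\<Union>j\<in>{1..s}. S j) = {1..t} - A"
proof (rule card_seteq)
  show "(\<Union>j\<in>{1..s}. S j) \<subseteq> {1..t} - A"
    using S T_range(2) by (fastforce simp: placements_def avail_def free_cols_def row_cols_def)
  have "card (\<Union>j\<in>{1..s}. S j) = (\<Sum>j=1..s. m (i j))"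
    using card_UN_placements[OF S] finite_free_cols by simp
  also have "\<dots> = (\<Sum>k=1..s. m k)" by (rule sum.reindex_bij_betw[OF enum])
  finally show "card ({1..t} - A) \<le> card (\<Union>j\<in>{1..s}. S j)"
    using enough A by (simp add: card_Diff_subset finite_subset)
qed simp

lemma ones_filling_of:
  assumes S: "S \<in> placements free_cols m' s"
  shows "ones T (filling_of S) = {(i j, c) | j c. j \<in> {1..s} \<and> c \<in> S j}"
proof -
  have "(i j, c) \<in> T" if "j \<in> {1..s}" "c \<in> S j" for j c
    using S that by (auto simp: placements_def avail_def free_cols_def row_cols_def)
  moreover have "filling_of S (a, c) = 1 \<longleftrightarrow> (\<exists>j\<in>{1..s}. a = i j \<and> c \<in> S j)"
    if "(a, c) \<in> T" for a c
    using that by (simp add: filling_of_def)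
  ultimately show ?thesis unfolding ones_def by fast
qed

lemma placement_filling_of:
  assumes S: "S \<in> placements free_cols m' s"
  shows "placement (filling_of S) = S"
proof
  fix j
  show "placement (filling_of S) j = S j"
  proof (cases "j \<in> {1..s}")
    case True
    then show ?thesis
      using i_eq_iff by (auto simp: placement_def ones_filling_of[OF S])
  next
    case False
    then have "S j = {}" using S by (auto simp: placements_def)
    with False show ?thesis by (auto simp: placement_def)
  qed
qed

lemma filling_of_in_NF:
  assumes S: "S \<in> placements free_cols (m \<circ> i) s"
    and enough: "t \<le> (\<Sum>k=1..s. m k) + card A"
  shows "filling_of S \<in> NF T m A"
proof -
  let ?F = "filling_of S"
  note ones = ones_filling_of[OF S]
  have "?F \<in> fillings01 T" by (auto simp: fillings01_def filling_of_def split: if_splits)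
  moreover have "card {x \<in> ones T ?F. fst x = a} = m a" if "a \<in> fst ` T" for a
  proof -
    have "a \<in> i ` {1..s}" using that rows enum by (simp add: bij_betw_def)
    then obtain j where j: "j \<in> {1..s}" "a = i j" by blast
    have "{x \<in> ones T ?F. fst x = a} = Pair a ` S j"
      unfolding ones using j i_eq_iff by auto
    then have "card {x \<in> ones T ?F. fst x = a} = card (S j)"
      by (simp add: card_image inj_on_def)
    then show ?thesis using S j by (simp add: placements_def)
  qed
  moreover have "card {x \<in> ones T ?F. snd x = c} \<le> 1" for c
  proof -
    have "x = y" if xy: "x \<in> {x \<in> ones T ?F. snd x = c}" "y \<in> {x \<in> ones T ?F. snd x = c}" for x y
    proof -
      obtain j k where "x = (i j, c)" "c \<in> S j" "y = (i k, c)" "c \<in> S k"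
        using xy unfolding ones by auto
      then show ?thesis using placements_disjoint[OF S, of j k] by (cases "j = k") auto
    qed
    moreover have "finite {x \<in> ones T ?F. snd x = c}"
      using finite_T ones_subset finite_subset by (metis (no_types, lifting) mem_Collect_eq subsetI)
    ultimately show ?thesis by (simp add: card_le_Suc0_iff_eq)
  qed
  \<comment> \<open>By \<open>UN_placements\<close> the chosen sets cover every column outside
    \<open>A\<close>, so none of these is empty, and they contain no column of \<open>A\<close>, so
    those stay empty.\<close>
  moreover have "EC T ?F = A"
  proof (intro equalityI subsetI)
    fix c assume c: "c \<in> EC T ?F"
    have "c \<notin> S j" if j: "j \<in> {1..s}" for j
    proof
      assume "c \<in> S j"
      then have "(i j, c) \<in> ones T ?F" using j unfolding ones by auto
      then show False using c by (auto simp: EC_def ones_def)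
    qed
    then have "c \<notin> {1..t} - A" using UN_placements[OF S enough] by blast
    then show "c \<in> A" using c cols by (auto simp: EC_def)
  next
    fix c assume c: "c \<in> A"
    then have "c \<in> snd ` T" using A cols by auto
    moreover have "c \<notin> S j" if j: "j \<in> {1..s}" for j
      using UN_placements[OF S enough] c j by blast
    then have "?F (a, c) = 0" if "(a, c) \<in> T" for a
      using that by (auto simp: filling_of_def)
    ultimately show "c \<in> EC T ?F" by (auto simp: EC_def)
  qed
  ultimately show ?thesis by (simp add: NF_def)
qed

lemma filling_of_placement:
  assumes F: "F \<in> NF T m A"
  shows "filling_of (placement F) = F"
proof
  fix x
  have F01: "F \<in> T \<rightarrow>\<^sub>E {0, 1}" using F by (simp add: NF_def fillings01_def)
  show "filling_of (placement F) x = F x"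
  proof (cases "x \<in> T")
    case False
    then show ?thesis using F01 by (auto simp: filling_of_def)
  next
    case True
    obtain a c where x: "x = (a, c)" by (cases x)
    obtain j where j: "j \<in> {1..s}" "a = i j" using row_cases True x by blast
    have "(\<exists>k\<in>{1..s}. a = i k \<and> c \<in> placement F k) \<longleftrightarrow> F x = 1"
      using j x True i_eq_iff by (auto simp: placement_def ones_def)
    moreover have "F x \<in> {0, 1}" using F01 True by (auto simp: PiE_iff)
    ultimately show ?thesis using True x by (auto simp: filling_of_def)
  qed
qed

lemma bij_betw_placement:
  assumes "t \<le> (\<Sum>k=1..s. m k) + card A"
  shows "bij_betw placement (NF T m A) (placements free_cols (m \<circ> i) s)"
  by (rule bij_betwI[where g = filling_of])
     (use assms placement_in_placements filling_of_in_NF filling_of_placement placement_filling_of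
      in \<open>auto simp: Pi_iff\<close>)

section \<open>Ascents and descents of a placement\<close>

text \<open>Pairs are grouped by their earlier row. A column \<open>d\<close> available but unchosen
  at position \<open>j\<close> is used at exactly one later position \<open>k\<close>: somewhere
  because no column is left over, not earlier because it is available, and only once because the
  sets are disjoint.\<close>

lemma card_later_pairs:
  fixes P :: "nat \<Rightarrow> nat \<Rightarrow> nat \<Rightarrow> bool"
  assumes S: "S \<in> placements free_cols (m \<circ> i) s"
    and enough: "t \<le> (\<Sum>k=1..s. m k) + card A"
  shows "card {{(i j, c), (i k, d)} | j k c d. j \<in> {1..s} \<and> k \<in> {1..s} \<and> j < k
             \<and> c \<in> S j \<and> d \<in> S k \<and> d \<in> free_cols j \<and> P j c d}
    = (\<Sum>j=1..s. card {(c, d). c \<in> S j \<and> d \<in> avail free_cols S j - S j \<and> P j c d})"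
proof -
  define Q where "Q = {(j, k, c, d). j \<in> {1..s} \<and> k \<in> {1..s} \<and> j < k
             \<and> c \<in> S j \<and> d \<in> S k \<and> d \<in> free_cols j \<and> P j c d}"
  let ?L = "{{(i j, c), (i k, d)} | j k c d. j \<in> {1..s} \<and> k \<in> {1..s} \<and> j < k
             \<and> c \<in> S j \<and> d \<in> S k \<and> d \<in> free_cols j \<and> P j c d}"
  let ?R = "\<lambda>j. {(c, d). c \<in> S j \<and> d \<in> avail free_cols S j - S j \<and> P j c d}"
  let ?set = "\<lambda>(j, k, c, d). {(i j, c), (i k, d)}"
  have "?L = ?set ` Q"
  proof (intro equalityI subsetI)
    fix z assume "z \<in> ?L"
    then obtain j k c d where "z = ?set (j, k, c, d)" "(j, k, c, d) \<in> Q" unfolding Q_def by blast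
    then show "z \<in> ?set ` Q" by (rule image_eqI)
  next
    fix z assume "z \<in> ?set ` Q"
    then obtain j k c d where "z = ?set (j, k, c, d)" "(j, k, c, d) \<in> Q" by fast
    then show "z \<in> ?L" unfolding Q_def by blast
  qed
  moreover have "inj_on ?set Q"
  proof (rule inj_onI)
    fix x y assume xy: "x \<in> Q" "y \<in> Q" "?set x = ?set y"
    obtain j k c d j' k' c' d' where x: "x = (j, k, c, d)" and y: "y = (j', k', c', d')"
      by (cases x, cases y)
    have Q: "(j, k, c, d) \<in> Q" "(j', k', c', d') \<in> Q"
      and eq: "{(i j, c), (i k, d)} = {(i j', c'), (i k', d')}"
      using xy x y by simp_all
    from eq consider "i j = i j' \<and> c = c' \<and> i k = i k' \<and> d = d'" | "i j = i k'" "i k = i j'"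
      unfolding doubleton_eq_iff by blast
    \<comment> \<open>Matching the two doubletons crosswise would give \<open>j = k'\<close> and
      \<open>k = j'\<close>, against \<open>j < k\<close> and \<open>j' < k'\<close>.\<close>
    then have "j = j' \<and> k = k' \<and> c = c' \<and> d = d'"
      using Q by cases (simp_all add: Q_def i_eq_iff)
    then show "x = y" using x y by simp
  qed
  ultimately have "card ?L = card Q" by (simp add: card_image)
  also have "card Q = card (Sigma {1..s} ?R)"
  proof (rule bij_betw_same_card[of "\<lambda>(j, k, c, d). (j, c, d)"], unfold bij_betw_def, intro conjI)
    show "inj_on (\<lambda>(j, k, c, d). (j, c, d)) Q"
    proof (rule inj_onI, clarsimp simp: Q_def)
      fix k k' d assume "d \<in> S k" "d \<in> S k'"
      then show "k = k'" using placements_disjoint[OF S, of k k'] by blast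
    qed
    show "(\<lambda>(j, k, c, d). (j, c, d)) ` Q = Sigma {1..s} ?R"
    proof (intro equalityI subsetI)
      fix x assume "x \<in> (\<lambda>(j, k, c, d). (j, c, d)) ` Q"
      then obtain j k c d where x: "x = (j, c, d)" "j \<in> {1..s}" "j < k" "c \<in> S j" "d \<in> S k"
        "d \<in> free_cols j" "P j c d" unfolding Q_def by auto
      have "d \<notin> S l" if "l \<le> j" for l
        using placements_disjoint[OF S, of l k] that x by auto
      then show "x \<in> Sigma {1..s} ?R" using x by (auto simp: avail_def)
    next
      fix x assume "x \<in> Sigma {1..s} ?R"
      then obtain j c d where x: "x = (j, c, d)" "j \<in> {1..s}" "c \<in> S j"
        "d \<in> avail free_cols S j" "d \<notin> S j" "P j c d" by auto
      then have d: "d \<in> free_cols j" "\<forall>l\<in>{1..<j}. d \<notin> S l" by (auto simp: avail_def)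
      then have "d \<in> {1..t} - A" using T_range(2) by (auto simp: free_cols_def row_cols_def)
      then obtain k where k: "k \<in> {1..s}" "d \<in> S k" using UN_placements[OF S enough] by blast
      then have "j < k" using d x by (metis atLeastAtMost_iff atLeastLessThan_iff linorder_neqE_nat)
      then have "(j, k, c, d) \<in> Q" using x d k by (simp add: Q_def)
      then show "x \<in> (\<lambda>(j, k, c, d). (j, c, d)) ` Q" using x(1) by force
    qed
  qed
  also have "\<dots> = (\<Sum>j=1..s. card (?R j))"
  proof (rule card_SigmaI)
    have "?R j \<subseteq> free_cols j \<times> free_cols j" if "j \<in> {1..s}" for j
      using S that by (fastforce simp: placements_def avail_def)
    from finite_subset[OF this] show "\<forall>j\<in>{1..s}. finite (?R j)"
      by (simp add: finite_free_cols)
  qed simp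
  finally show ?thesis .
qed

text \<open>The corner \<open>(i j, d)\<close> decides. Once it is in \<open>T\<close>, row
  convexity fills the side in row \<open>i j\<close>, the later row contains these columns by
  \<open>row_cols_chain\<close>, and column convexity fills the rest.\<close>

lemma rectangle_subset_iff:
  assumes jk: "1 \<le> j" "j < k" "k \<le> s" and c: "(i j, c) \<in> T" and d: "(i k, d) \<in> T"
  shows "rectangle (i j, c) (i k, d) \<subseteq> T \<longleftrightarrow> (i j, d) \<in> T"
proof
  assume "rectangle (i j, c) (i k, d) \<subseteq> T"
  then show "(i j, d) \<in> T" by (auto simp: rectangle_def)
next
  have conv: "(a, e) \<in> T \<Longrightarrow> (a, g) \<in> T \<Longrightarrow> e \<le> f \<Longrightarrow> f \<le> g \<Longrightarrow> (a, f) \<in> T"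
    "(a, f) \<in> T \<Longrightarrow> (b, f) \<in> T \<Longrightarrow> a \<le> l \<Longrightarrow> l \<le> b \<Longrightarrow> (l, f) \<in> T" for a b e f g l
    using moon unfolding moon_polyomino_def convex_polyomino_def by blast+
  assume dj: "(i j, d) \<in> T"
  show "rectangle (i j, c) (i k, d) \<subseteq> T"
  proof
    fix x assume "x \<in> rectangle (i j, c) (i k, d)"
    then obtain l f where x: "x = (l, f)" "min (i j) (i k) \<le> l" "l \<le> max (i j) (i k)"
      "min c d \<le> f" "f \<le> max c d"
      by (auto simp: rectangle_def)
    have ij: "(i j, f) \<in> T"
      using x(4,5) conv(1)[OF c dj, of f] conv(1)[OF dj c, of f] by linarith
    then have ik: "(i k, f) \<in> T"
      using row_cols_chain[of j k] jk by (auto simp: row_cols_def)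
    show "x \<in> T"
      using x(1-3) conv(2)[OF ij ik, of l] conv(2)[OF ik ij, of l] by (metis max_def min_def)
  qed
qed

lemma rectangle_commute: "rectangle x y = rectangle y x"
  by (simp add: rectangle_def min.commute max.commute)

lemma ones_iff_placement: "j \<in> {1..s} \<Longrightarrow> (i j, c) \<in> ones T F \<longleftrightarrow> c \<in> placement F j"
  by (simp add: placement_def)

lemma rectangle_ones_iff:
  assumes F: "F \<in> NF T m A" and jk: "j \<in> {1..s}" "k \<in> {1..s}" "j < k"
    and c: "c \<in> placement F j" and d: "d \<in> placement F k"
  shows "rectangle (i j, c) (i k, d) \<subseteq> T \<longleftrightarrow> d \<in> free_cols j"
proof -
  have "(i j, c) \<in> T" "(i k, d) \<in> T"
    using c d jk ones_iff_placement ones_subset by blast+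
  moreover have "d \<notin> A"
    using placement_in_placements[OF F] d jk by (auto simp: placements_def avail_def free_cols_def)
  ultimately show ?thesis
    using rectangle_subset_iff[of j k c d] jk by (auto simp: free_cols_def row_cols_def)
qed

text \<open>With \<open>R\<close> being \<open><\<close> or \<open>>\<close>, the left-hand side is the set of ascents or of descents.\<close>

lemma crossing_pairs_eq:
  assumes F: "F \<in> NF T m A"
    and R: "\<And>j k. j \<in> {1..s} \<Longrightarrow> k \<in> {1..s} \<Longrightarrow> j < k \<Longrightarrow> R (i j) (i k) \<longleftrightarrow> U j"
      "\<And>j k. j \<in> {1..s} \<Longrightarrow> k \<in> {1..s} \<Longrightarrow> j < k \<Longrightarrow> R (i k) (i j) \<longleftrightarrow> \<not> U j"
      "\<And>a. \<not> R a a"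
  shows "{{x, y} | x y. x \<in> ones T F \<and> y \<in> ones T F \<and>
            R (fst x) (fst y) \<and> snd x > snd y \<and> rectangle x y \<subseteq> T}
    = {{(i j, c), (i k, d)} | j k c d. j \<in> {1..s} \<and> k \<in> {1..s} \<and> j < k
         \<and> c \<in> placement F j \<and> d \<in> placement F k \<and> d \<in> free_cols j
         \<and> (if U j then d < c else c < d)}" (is "?L = ?M")
proof (intro equalityI subsetI)
  fix z assume "z \<in> ?L"
  then obtain x y where z: "z = {x, y}" and xy: "x \<in> ones T F" "y \<in> ones T F"
    "R (fst x) (fst y)" "snd x > snd y" "rectangle x y \<subseteq> T" by blast
  obtain a c b d where ab: "x = (a, c)" "y = (b, d)" by (cases x, cases y)
  obtain j where j: "j \<in> {1..s}" "a = i j" using row_cases xy(1) ab ones_subset by blast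
  obtain k where k: "k \<in> {1..s}" "b = i k" using row_cases xy(2) ab ones_subset by blast
  have cd: "c \<in> placement F j" "d \<in> placement F k"
    using xy ab j k ones_iff_placement by auto
  have "j \<noteq> k" using xy(3) R(3) ab j k by auto
  \<comment> \<open>\<open>x\<close> is the right-hand 1. If it lies in the earlier row, the later 1
    is to its left; otherwise the two exchange roles and the later 1 is on the right.\<close>
  then consider "j < k" | "k < j" by linarith
  then show "z \<in> ?M"
  proof cases
    case 1
    then have "U j" using R(1)[OF j(1) k(1)] xy(3) ab j k by simp
    moreover have "d \<in> free_cols j"
      using rectangle_ones_iff[OF F j(1) k(1) 1 cd] xy(5) ab j k by simp
    ultimately show ?thesis using z ab j k cd 1 xy(4)
      by (intro CollectI exI[of _ j] exI[of _ k] exI[of _ c] exI[of _ d]) simp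
  next
    case 2
    then have "\<not> U k" using R(2)[OF k(1) j(1)] xy(3) ab j k by simp
    moreover have "c \<in> free_cols k"
      using rectangle_ones_iff[OF F k(1) j(1) 2 cd(2,1)] xy(5) ab j k by (simp add: rectangle_commute)
    ultimately show ?thesis using z ab j k cd 2 xy(4)
      by (intro CollectI exI[of _ k] exI[of _ j] exI[of _ d] exI[of _ c]) (simp add: insert_commute)
  qed
next
  fix z assume "z \<in> ?M"
  then obtain j k c d where z: "z = {(i j, c), (i k, d)}" and jk: "j \<in> {1..s}" "k \<in> {1..s}" "j < k"
    and cd: "c \<in> placement F j" "d \<in> placement F k" "d \<in> free_cols j"
    and U: "if U j then d < c else c < d" by blast
  have ones: "(i j, c) \<in> ones T F" "(i k, d) \<in> ones T F" using jk cd ones_iff_placement by auto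
  have rect: "rectangle (i j, c) (i k, d) \<subseteq> T" using rectangle_ones_iff[OF F jk cd(1,2)] cd by simp
  show "z \<in> ?L"
  proof (cases "U j")
    case True
    then show ?thesis using z ones rect U R(1)[OF jk]
      by (intro CollectI exI[of _ "(i j, c)"] exI[of _ "(i k, d)"]) simp
  next
    case False
    then show ?thesis using z ones rect U R(2)[OF jk] rectangle_commute[of "(i j, c)"]
      by (intro CollectI exI[of _ "(i k, d)"] exI[of _ "(i j, c)"]) (simp add: insert_commute)
  qed
qed

text \<open>After a row in \<open>Up\<close> the later 1 is below, so in an ascent it lies to the
  left; after a row in \<open>Low\<close> it is above and lies to the right.\<close>

lemma ne2_eq:
  assumes F: "F \<in> NF T m A" and enough: "t \<le> (\<Sum>k=1..s. m k) + card A"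
  shows "ne2 T F = (\<Sum>j=1..s. card ((if i j \<in> Up T s then left_pairs else right_pairs)
           (placement F j) (avail free_cols (placement F) j)))"
proof -
  have "ascents T F = {{(i j, c), (i k, d)} | j k c d. j \<in> {1..s} \<and> k \<in> {1..s} \<and> j < k
         \<and> c \<in> placement F j \<and> d \<in> placement F k \<and> d \<in> free_cols j
         \<and> (if i j \<in> Up T s then d < c else c < d)}"
    unfolding ascents_def
  proof (rule crossing_pairs_eq[OF F])
    fix j k assume jk: "j \<in> {1..s}" "k \<in> {1..s}" "j < k"
    then show "i j < i k \<longleftrightarrow> i j \<in> Up T s" using later_row_position by simp
    then show "i k < i j \<longleftrightarrow> \<not> i j \<in> Up T s" using i_eq_iff[of j k] jk by linarith
  qed simp
  then have "ne2 T F = (\<Sum>j=1..s. card {(c, d). c \<in> placement F j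
      \<and> d \<in> avail free_cols (placement F) j - placement F j
      \<and> (if i j \<in> Up T s then d < c else c < d)})"
    unfolding ne2_def
    by (simp only: card_later_pairs[OF placement_in_placements[OF F] enough])
  then show ?thesis
    by (auto simp: left_pairs_def right_pairs_def intro!: sum.cong)
qed

text \<open>Descents reverse the vertical relation: \<open>R\<close> is now \<open>>\<close> and
  \<open>U j\<close> becomes \<open>i j \<notin> Up T s\<close>.\<close>

lemma se2_eq:
  assumes F: "F \<in> NF T m A" and enough: "t \<le> (\<Sum>k=1..s. m k) + card A"
  shows "se2 T F = (\<Sum>j=1..s. card ((if i j \<in> Up T s then right_pairs else left_pairs)
           (placement F j) (avail free_cols (placement F) j)))"
proof -
  have "descents T F = {{(i j, c), (i k, d)} | j k c d. j \<in> {1..s} \<and> k \<in> {1..s} \<and> j < k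
         \<and> c \<in> placement F j \<and> d \<in> placement F k \<and> d \<in> free_cols j
         \<and> (if i j \<notin> Up T s then d < c else c < d)}"
    unfolding descents_def
  proof (rule crossing_pairs_eq[OF F])
    fix j k assume jk: "j \<in> {1..s}" "k \<in> {1..s}" "j < k"
    then have "i j < i k \<longleftrightarrow> i j \<in> Up T s" using later_row_position by simp
    then show "i j > i k \<longleftrightarrow> i j \<notin> Up T s" "i k > i j \<longleftrightarrow> \<not> i j \<notin> Up T s"
      using i_eq_iff[of j k] jk by linarith+
  qed simp
  then have "se2 T F = (\<Sum>j=1..s. card {(c, d). c \<in> placement F j
      \<and> d \<in> avail free_cols (placement F) j - placement F j
      \<and> (if i j \<notin> Up T s then d < c else c < d)})"
    unfolding se2_def
    by (simp only: card_later_pairs[OF placement_in_placements[OF F] enough])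
  then show ?thesis
    by (auto simp: left_pairs_def right_pairs_def intro!: sum.cong)
qed

text \<open>The weights \<open>W\<close> and values \<open>G\<close> are left open so that one
  argument yields both the generating function and the cardinality.\<close>

lemma sum_NF_eq_prod:
  fixes W :: "nat \<Rightarrow> nat set \<Rightarrow> nat set \<Rightarrow> 'b::comm_semiring_1"
  assumes enough: "t \<le> (\<Sum>k=1..s. m k) + card A"
    and h: "\<forall>j\<in>{1..s}. h (i j) = int (row_len T (i j)) - int (\<Sum>l\<in>{1..<j}. m (i l))
              - int (card {k \<in> A. k \<in> row_cols T (i j)})"
    and W: "\<And>j V. finite V \<Longrightarrow> (\<Sum>U | U \<subseteq> V \<and> card U = m (i j). W j U V) = G (int (card V)) (m (i j))"
  shows "(\<Sum>F\<in>NF T m A. \<Prod>j=1..s. W j (placement F j) (avail free_cols (placement F) j))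
           = (\<Prod>j=1..s. G (h j) (m j))"
proof -
  have h_eq: "int (card (free_cols j)) - int (\<Sum>l\<in>{1..<j}. m (i l)) = h (i j)" if "j \<in> {1..s}" for j
  proof -
    have "int (card (free_cols j)) = int (card (row_cols T (i j))) - int (card (row_cols T (i j) \<inter> A))"
      unfolding free_cols_def using finite_row_cols card_Diff_subset_Int[of "row_cols T (i j)" A]
      by (simp add: card_mono of_nat_diff)
    moreover have "row_cols T (i j) \<inter> A = {k \<in> A. k \<in> row_cols T (i j)}" by auto
    ultimately show ?thesis using h that by (simp add: row_len_def)
  qed
  have "(\<Sum>F\<in>NF T m A. \<Prod>j=1..s. W j (placement F j) (avail free_cols (placement F) j))
      = (\<Sum>S\<in>placements free_cols (m \<circ> i) s. \<Prod>j=1..s. W j (S j) (avail free_cols S j))"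
    by (rule sum.reindex_bij_betw[OF bij_betw_placement[OF enough]])
  also have "\<dots> = (\<Prod>j=1..s. G (int (card (free_cols j)) - int (\<Sum>l\<in>{1..<j}. (m \<circ> i) l)) ((m \<circ> i) j))"
  proof (rule sum_placements)
    show "free_cols j \<subseteq> free_cols k" if "1 \<le> j" "j < k" "k \<le> s" for j k
      using row_cols_chain[of j k] that by (auto simp: free_cols_def)
  qed (use W finite_free_cols in auto)
  also have "\<dots> = (\<Prod>j=1..s. G (h (i j)) (m (i j)))"
    by (intro prod.cong refl) (simp only: h_eq o_apply)
  \<comment> \<open>The product so far runs over positions; the bijection \<open>i\<close>
    rearranges it into one over row labels, which index \<open>h\<close> and
    \<open>m\<close>.\<close>
  also have "\<dots> = (\<Prod>j=1..s. G (h j) (m j))"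
    by (rule prod.reindex_bij_betw[OF enum])
  finally show ?thesis .
qed

end

text \<open>In a member of \<open>NF T m A\<close> each column outside \<open>A\<close> holds
  exactly one 1, so the \<open>m k\<close> add up to \<open>t - card A\<close>. If fewer 1's are
  prescribed, the set is empty while the product can be positive; \<open>enough\<close> excludes
  this case.\<close>

theorem theorem3p1:
  fixes T :: "cell set" and s t :: nat and m :: "nat \<Rightarrow> nat" and A :: "nat set"
    and i :: "nat \<Rightarrow> nat" and h :: "nat \<Rightarrow> int"
  assumes moon: "moon_polyomino T"
    and rows: "fst ` T = {1..s}"
    and cols: "snd ` T = {1..t}"
    and A: "A \<subseteq> {1..t}"
    and enough: "t \<le> (\<Sum>k=1..s. m k) + card A"
    and enum: "bij_betw i {1..s} {1..s}"
    and ordered: "\<forall>j\<in>{1..s}. \<forall>k\<in>{1..s}. j < k \<longrightarrow> row_less T s (i j) (i k)"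
    and h: "\<forall>j\<in>{1..s}. h (i j) = int (row_len T (i j)) - int (\<Sum>l\<in>{1..<j}. m (i l))
              - int (card {k \<in> A. k \<in> row_cols T (i j)})"
  shows "(\<Sum>F\<in>NF T m A. var_p ^ ne2 T F * var_q ^ se2 T F)
           = (\<Prod>j=1..s. pq_binomial var_p var_q (h j) (m j))
         \<and> card (NF T m A) = (\<Prod>j=1..s. binomial_int (h j) (m j))"
proof
  interpret moon_rows T s t A i
    by unfold_locales (fact moon rows cols A enum ordered)+
  \<comment> \<open>\<open>p\<close> marks ascents and \<open>q\<close> descents; these are left and
    right pairs respectively for a row in \<open>Up\<close>, and the reverse for a row in
    \<open>Low\<close>.\<close>
  let ?W = "\<lambda>j S V. var_p ^ card ((if i j \<in> Up T s then left_pairs else right_pairs) S V)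
              * var_q ^ card ((if i j \<in> Up T s then right_pairs else left_pairs) S V)"
  have "(\<Sum>F\<in>NF T m A. var_p ^ ne2 T F * var_q ^ se2 T F)
      = (\<Sum>F\<in>NF T m A. \<Prod>j=1..s. ?W j (placement F j) (avail free_cols (placement F) j))"
    by (intro sum.cong refl) (simp only: ne2_eq[OF _ enough] se2_eq[OF _ enough] power_sum prod.distrib)
  also have "\<dots> = (\<Prod>j=1..s. pq_binomial var_p var_q (h j) (m j))"
  proof (rule sum_NF_eq_prod[OF enough h])
    fix j and V :: "nat set" assume V: "finite V"
    have pq: "pq_binomial var_p var_q (int (card V)) k = gauss var_p var_q (card V) k" for k
      by (rule pq_binomial_eq_gauss) (rule pq_int_vars_nonzero)
    \<comment> \<open>A row in \<open>Low\<close> produces the coefficient with \<open>p\<close> and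
      \<open>q\<close> exchanged, which is the same by symmetry.\<close>
    have qp: "pq_binomial var_p var_q (int (card V)) k = gauss var_q var_p (card V) k" for k
      unfolding pq_binomial_commute[of var_p]
      by (rule pq_binomial_eq_gauss) (simp add: pq_int_commute[of var_q] pq_int_vars_nonzero)
    show "(\<Sum>U | U \<subseteq> V \<and> card U = m (i j). ?W j U V)
        = pq_binomial var_p var_q (int (card V)) (m (i j))"
    proof (cases "i j \<in> Up T s")
      case True
      then show ?thesis using sum_pairs_eq_gauss[OF V, where p = var_p and q = var_q] pq by simp
    next
      case False
      then show ?thesis using sum_pairs_eq_gauss[OF V, where p = var_q and q = var_p] qp
        by (simp add: mult.commute)
    qed
  qed
  finally show "(\<Sum>F\<in>NF T m A. var_p ^ ne2 T F * var_q ^ se2 T F)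
      = (\<Prod>j=1..s. pq_binomial var_p var_q (h j) (m j))" .
  \<comment> \<open>With all weights 1 and \<open>G = binomial_int\<close>, the condition on
    \<open>W\<close> is the count of subsets of a given size.\<close>
  have "(\<Sum>F\<in>NF T m A. \<Prod>j=1..s. 1) = (\<Prod>j=1..s. binomial_int (h j) (m j))"
    by (rule sum_NF_eq_prod[OF enough h])
       (auto simp: n_subsets binomial_int_def binomial_eq_0)
  then show "card (NF T m A) = (\<Prod>j=1..s. binomial_int (h j) (m j))" by simp
qed

end
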